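(* Let $H=H(b,\delta,\lambda)$ be a balanced HST, let $W$ be a random $n$-element submultiset of its leaves, and let $h=\min(\delta,\log_b n)$. Then \[\mathbf{E}[TSP(W)]=\Theta\Big(\sum_{\ell=1}^{h}(b\lambda)^\ell\Big),\] where the implied constants depend only on $b$ and $\lambda$.
   Context: A balanced HST $H(b,\delta,\lambda)$ (integers $b\ge2$, $\delta\ge1$, real $0<\lambda<1$) is a rooted tree in which every non-leaf vertex has exactly $b$ children and every leaf is at depth $\delta$; the root is at level $0$, and each edge joining a vertex at level $\ell-1$ to a child at level $\ell$ has weight $\lambda^\ell$. The distance $d_H(x,y)$ is the total weight of the tree path between $x$ and $y$. A random $n$-element submultiset of the leaves is obtained by choosing $n$ leaves independently and uniformly at random (repetitions allowed); copies of the same leaf are treated as distinct points at distance $0$. $TSP(V)$ is the minimum total weight (with respect to $d_H$) of a Hamiltonian cycle in the complete graph on the multiset $V$. The sum ranges over integers $\ell$ with $1\le\ell\le h$.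
   Formalization: The formal theorem assumes n ≥ b: for 2 ≤ n < b the sum over 1 ≤ ℓ ≤ h is empty, hence 0, while E[TSP(W)] > 0, so the stated upper bound fails; the trivial case n = 1 (0 = Θ(0)) is also left out. *)

theory Defs
  imports
    "HOL-Probability.Probability"
    "HOL-Combinatorics.Multiset_Permutations"
    "Graph_Theory.Graph_Theory"
begin

text \<open>
  A vertex of the balanced HST is the word over \<open>{0..<b}\<close> that records the children chosen on
  the way down from the root \<open>[]\<close>; its level is its length. As is usual in the digraph library,
  an undirected edge is a pair of opposite arcs.
\<close>

definition hst :: "nat \<Rightarrow> nat \<Rightarrow> nat list pair_pre_digraph" where
  "hst b \<delta> =
    (let V = {u. set u \<subseteq> {..<b} \<and> length u \<le> \<delta>};
         child = (\<lambda>u v. \<exists>i. v = u @ [i])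
     in \<lparr>pverts = V, parcs = {(u, v). u \<in> V \<and> v \<in> V \<and> (child u v \<or> child v u)}\<rparr>)"

definition hst_leaves :: "nat \<Rightarrow> nat \<Rightarrow> nat list set" where
  "hst_leaves b \<delta> = {u \<in> pverts (hst b \<delta>). length u = \<delta>}"

text \<open>The longer endpoint of an edge is the child, so its length is the level \<open>\<ell>\<close> of the edge.\<close>

definition hst_weight :: "real \<Rightarrow> nat list \<times> nat list \<Rightarrow> real" where
  "hst_weight lam e = lam ^ max (length (fst e)) (length (snd e))"

definition hst_dist :: "nat \<Rightarrow> nat \<Rightarrow> real \<Rightarrow> nat list \<Rightarrow> nat list \<Rightarrow> real" where
  "hst_dist b \<delta> lam x y =
     sum_list (map (hst_weight lam) (THE p. pre_digraph.apath (with_proj (hst b \<delta>)) x p y))"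

text \<open>
  A Hamiltonian cycle through the points of a multiset is a cyclic enumeration of its elements
  with multiplicities. For two points this is the tour going back and forth between them, and for
  a single point it has weight \<open>d x x\<close>.
\<close>

definition tour_weight :: "('a \<Rightarrow> 'a \<Rightarrow> real) \<Rightarrow> 'a list \<Rightarrow> real" where
  "tour_weight d xs = (\<Sum>i<length xs. d (xs ! i) (xs ! (Suc i mod length xs)))"

definition TSP :: "('a \<Rightarrow> 'a \<Rightarrow> real) \<Rightarrow> 'a multiset \<Rightarrow> real" where
  "TSP d V = Min (tour_weight d ` permutations_of_multiset V)"

definition random_submultiset :: "nat \<Rightarrow> 'a set \<Rightarrow> 'a multiset pmf" where
  "random_submultiset n A = map_pmf mset (replicate_pmf n (pmf_of_set A))"

text \<open>The path in the definition of \<^const>\<open>hst_dist\<close> exists and is unique.\<close>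

lemma hst_verts: "pverts (hst b \<delta>) = {u. set u \<subseteq> {..<b} \<and> length u \<le> \<delta>}"
  by (simp add: hst_def Let_def)

lemma hst_arcs_iff:
  "(u, v) \<in> parcs (hst b \<delta>) \<longleftrightarrow>
     u \<in> pverts (hst b \<delta>) \<and> v \<in> pverts (hst b \<delta>) \<and> ((\<exists>i. v = u @ [i]) \<or> (\<exists>i. u = v @ [i]))"
  by (auto simp: hst_def Let_def)

interpretation hst: pair_wf_digraph "hst b \<delta>" for b \<delta>
  by unfold_locales (auto simp: hst_arcs_iff)

lemma hst_children:
  assumes "u \<in> pverts (hst b \<delta>)" "u \<notin> hst_leaves b \<delta>"
  shows "card {v. (u, v) \<in> parcs (hst b \<delta>) \<and> length v = Suc (length u)} = b"
proof -
  have "{v. (u, v) \<in> parcs (hst b \<delta>) \<and> length v = Suc (length u)} = (\<lambda>i. u @ [i]) ` {..<b}"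
  proof (intro equalityI subsetI)
    fix v assume v: "v \<in> {v. (u, v) \<in> parcs (hst b \<delta>) \<and> length v = Suc (length u)}"
    then obtain i where "v = u @ [i]" unfolding hst_arcs_iff by fastforce
    with v show "v \<in> (\<lambda>i. u @ [i]) ` {..<b}" by (simp add: hst_arcs_iff hst_verts)
  next
    fix v assume "v \<in> (\<lambda>i. u @ [i]) ` {..<b}"
    then obtain i where "i < b" "v = u @ [i]" by blast
    with assms show "v \<in> {v. (u, v) \<in> parcs (hst b \<delta>) \<and> length v = Suc (length u)}"
      by (simp add: hst_arcs_iff hst_verts hst_leaves_def)
  qed
  then show ?thesis by (simp add: card_image inj_on_def)
qed

lemma hst_invariant:
  assumes "hst.awalk b \<delta> x p y" "u \<notin> set (hst.awalk_verts x p)" "P x"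
    and step: "\<And>s t. (s, t) \<in> parcs (hst b \<delta>) \<Longrightarrow> P s \<Longrightarrow> t \<noteq> u \<Longrightarrow> P t"
  shows "P y"
  using assms(1-3)
proof (induction p arbitrary: x)
  case Nil
  then show ?case by (simp add: hst.awalk_Nil_iff)
next
  case (Cons e p)
  obtain s t where e: "e = (s, t)" by fastforce
  from Cons.prems have w: "(x, t) \<in> parcs (hst b \<delta>)" "s = x" "hst.awalk b \<delta> t p y"
    by (auto simp: hst.awalk_Cons_iff e)
  have u: "u \<notin> set (hst.awalk_verts t p)"
    using Cons.prems(2) by (simp add: e)
  have "t \<in> set (hst.awalk_verts t p)"
    by (cases p) (use w(3) in \<open>auto simp: hst.awalk_Cons_iff\<close>)
  with u step[OF w(1) Cons.prems(3)] have "P t" by blast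
  from Cons.IH[OF w(3) u this] show ?case .
qed

lemma hst_apath_unique:
  assumes "hst.apath b \<delta> x p y" "hst.apath b \<delta> x q y"
  shows "p = q"
  using assms
proof (induction p arbitrary: x q)
  case Nil
  then have "x = y" by (simp add: hst.apath_Nil_iff)
  with Nil.prems(2) show ?case using hst.apath_nonempty_ends by blast
next
  case (Cons e p)
  have "x \<noteq> y" using Cons.prems(1) hst.apath_nonempty_ends by blast
  then obtain f q' where q: "q = f # q'"
    using Cons.prems(2) by (cases q) (auto simp: hst.apath_Nil_iff)
  obtain s t where e: "e = (s, t)" by fastforce
  obtain s' t' where f: "f = (s', t')" by fastforce
  from Cons.prems(1) have 1: "s = x" "(x, t) \<in> parcs (hst b \<delta>)" "hst.apath b \<delta> t p y"
      "x \<notin> set (hst.awalk_verts t p)"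
    by (auto simp: hst.apath_Cons_iff e)
  from Cons.prems(2) have 2: "s' = x" "(x, t') \<in> parcs (hst b \<delta>)" "hst.apath b \<delta> t' q' y"
      "x \<notin> set (hst.awalk_verts t' q')"
    by (auto simp: hst.apath_Cons_iff f q)
  have down: "prefix (x @ [i]) y"
    if "hst.apath b \<delta> (x @ [i]) r y" "x \<notin> set (hst.awalk_verts (x @ [i]) r)" for i r
  proof (rule hst_invariant[where P = "prefix (x @ [i])", OF hst.awalkI_apath[OF that(1)] that(2)])
    fix v w assume vw: "(v, w) \<in> parcs (hst b \<delta>)" "prefix (x @ [i]) v" "w \<noteq> x"
    from vw(1) consider j where "w = v @ [j]" | j where "v = w @ [j]"
      unfolding hst_arcs_iff by blast
    then show "prefix (x @ [i]) w"
    proof cases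
      case 1 with vw(2) show ?thesis by (simp only: prefix_snoc) simp
    next
      case 2 with vw(2,3) show ?thesis by (simp only: prefix_snoc) blast
    qed
  qed simp
  have up: "\<not> prefix x y"
    if "x = z @ [i]" "hst.apath b \<delta> z r y" "x \<notin> set (hst.awalk_verts z r)" for z i r
  proof (rule hst_invariant[where P = "\<lambda>v. \<not> prefix x v", OF hst.awalkI_apath[OF that(2)] that(3)])
    show "\<not> prefix x z"
    proof
      assume "prefix x z"
      then have "length x \<le> length z" by (rule prefix_length_le)
      then show False unfolding that(1) by simp
    qed
    fix v w assume vw: "(v, w) \<in> parcs (hst b \<delta>)" "\<not> prefix x v" "w \<noteq> x"
    from vw(1) consider j where "w = v @ [j]" | j where "v = w @ [j]"
      unfolding hst_arcs_iff by blast
    then show "\<not> prefix x w"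
    proof cases
      case 1 with vw(2,3) show ?thesis by (simp only: prefix_snoc) blast
    next
      case 2 with vw(2) show ?thesis by (simp only: prefix_snoc) blast
    qed
  qed
  have d: "i = j" if ij: "prefix (x @ [i]) y" "prefix (x @ [j]) y" for i j
  proof -
    obtain zs where "y = x @ i # zs" using ij(1) by (auto simp: prefix_def)
    moreover obtain zs' where "y = x @ j # zs'" using ij(2) by (auto simp: prefix_def)
    ultimately show ?thesis by simp
  qed
  have u: "prefix x y" if "prefix (x @ [i]) y" for i
    using that append_prefixD by blast
  consider (dd) i j where "t = x @ [i]" "t' = x @ [j]" | (du) i j where "t = x @ [i]" "x = t' @ [j]"
    | (ud) i j where "x = t @ [i]" "t' = x @ [j]" | (uu) i j where "x = t @ [i]" "x = t' @ [j]"
    using 1(2) 2(2) unfolding hst_arcs_iff by blast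
  then have t: "t = t'"
  proof cases
    case dd
    have "prefix (x @ [i]) y" using down 1(3,4) unfolding dd by blast
    moreover have "prefix (x @ [j]) y" using down 2(3,4) unfolding dd by blast
    ultimately show ?thesis using d dd by blast
  next
    case du
    have "prefix (x @ [i]) y" using down 1(3,4) unfolding du(1) by blast
    then show ?thesis using u up[OF du(2) 2(3,4)] by blast
  next
    case ud
    have "prefix (x @ [j]) y" using down 2(3,4) unfolding ud(2) by blast
    then show ?thesis using u up[OF ud(1) 1(3,4)] by blast
  next
    case uu
    then have "t @ [i] = t' @ [j]" by (rule subst)
    then show ?thesis by (simp only: append1_eq_conv)
  qed
  have "p = q'" using Cons.IH[OF 1(3)] 2(3) unfolding t by blast
  then show ?case unfolding e f q t 1(1) 2(1) by (rule arg_cong)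
qed

lemma hst_awalk_root:
  assumes "u \<in> pverts (hst b \<delta>)"
  shows "(\<exists>p. hst.awalk b \<delta> [] p u) \<and> (\<exists>p. hst.awalk b \<delta> u p [])"
  using assms
proof (induction u rule: rev_induct)
  case Nil
  then have "hst.awalk b \<delta> [] [] []" by (simp add: hst.awalk_Nil_iff)
  then show ?case by blast
next
  case (snoc i u)
  have u: "u \<in> pverts (hst b \<delta>)"
    using snoc.prems by (auto simp: hst_verts)
  have a: "(u, u @ [i]) \<in> parcs (hst b \<delta>)" "(u @ [i], u) \<in> parcs (hst b \<delta>)"
    using snoc.prems u by (auto simp: hst_arcs_iff)
  obtain p q where p: "hst.awalk b \<delta> [] p u" and q: "hst.awalk b \<delta> u q []"
    using snoc.IH[OF u] by blast
  have "hst.awalk b \<delta> u [(u, u @ [i])] (u @ [i])"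
    using a(1) snoc.prems by (simp add: hst.awalk_Cons_iff hst.awalk_Nil_iff)
  then have "hst.awalk b \<delta> [] (p @ [(u, u @ [i])]) (u @ [i])"
    by (rule hst.awalk_appendI[OF p])
  moreover have "hst.awalk b \<delta> (u @ [i]) ((u @ [i], u) # q) []"
    using a(2) q by (simp add: hst.awalk_Cons_iff)
  ultimately show ?case by blast
qed

lemma hst_ex1_apath:
  assumes "x \<in> pverts (hst b \<delta>)" "y \<in> pverts (hst b \<delta>)"
  shows "\<exists>!p. hst.apath b \<delta> x p y"
proof -
  obtain p q where "hst.awalk b \<delta> x p []" "hst.awalk b \<delta> [] q y"
    using hst_awalk_root assms by blast
  then have "hst.awalk b \<delta> x (p @ q) y" by (rule hst.awalk_appendI)
  then have "hst.apath b \<delta> x (hst.awalk_to_apath b \<delta> (p @ q)) y"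
    by (rule hst.apath_awalk_to_apath)
  then show ?thesis using hst_apath_unique by blast
qed

end

theory Submission
  imports Defs "HOL-Library.List_Lexorder"
begin

text \<open>
  Two leaves are at distance \<open>2 \<Sum> \<lambda>\<^sup>l\<close>, summed over the levels \<open>l\<close> at which their ancestors differ.
  Hence the weight of a tour counts, at each level, how often the ancestor changes along the
  tour. If \<open>N\<^sub>l\<close> is the number of occupied vertices at level \<open>l\<close>, every tour has at least
  \<open>N\<^sub>l - 1\<close> changes, and the lexicographic tour has at most \<open>N\<^sub>l\<close> of them, simultaneously at all
  levels. From \<open>N\<^sub>l \<le> min (b\<^sup>l) n\<close> one gets the upper bound, the levels with \<open>b\<^sup>l > n\<close>
  contributing a geometric tail. For the lower bound, \<open>E N\<^sub>l = b\<^sup>l (1 - (1 - b\<^sup>-\<^sup>l)\<^sup>n)\<close>, which is at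
  least \<open>b\<^sup>l (1 - 1/e)\<close> when \<open>b\<^sup>l \<le> n\<close>; since \<open>b\<^sup>l \<ge> 2\<close> and \<open>e > 2\<close>, subtracting \<open>1\<close> still leaves
  a constant fraction of \<open>b\<^sup>l\<close>.
\<close>

section \<open>Paths and distances in the tree\<close>

lemma hst_weight_child [simp]:
  "hst_weight lam (u, u @ [i]) = lam ^ Suc (length u)"
  "hst_weight lam (u @ [i], u) = lam ^ Suc (length u)"
  by (simp_all add: hst_weight_def)

text \<open>The claim on visited vertices is carried for the induction: the path from the child
  \<open>u @ [i]\<close> meets only extensions of \<open>u @ [i]\<close>, so putting
  \<open>u\<close> in front of it repeats no vertex.\<close>

lemma apath_down:
  assumes "u @ v \<in> pverts (hst b \<delta>)"
  shows "\<exists>p. hst.apath b \<delta> u p (u @ v) \<and>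
    set (hst.awalk_verts u p) \<subseteq> {z. prefix u z \<and> prefix z (u @ v)} \<and>
    sum_list (map (hst_weight lam) p) = (\<Sum>l\<in>{length u<..length (u @ v)}. lam ^ l)"
  using assms
proof (induction v arbitrary: u)
  case Nil
  then show ?case
    by (intro exI[of _ "[]"]) (simp add: hst.apath_Nil_iff)
next
  case (Cons i v)
  obtain p where p: "hst.apath b \<delta> (u @ [i]) p (u @ i # v)"
    "set (hst.awalk_verts (u @ [i]) p) \<subseteq> {z. prefix (u @ [i]) z \<and> prefix z (u @ i # v)}"
    "sum_list (map (hst_weight lam) p)
      = (\<Sum>l\<in>{Suc (length u)<..length (u @ i # v)}. lam ^ l)"
    using Cons.IH[of "u @ [i]"] Cons.prems by auto
  have arc: "(u, u @ [i]) \<in> parcs (hst b \<delta>)"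
    using Cons.prems by (auto simp: hst_arcs_iff hst_verts)
  have "u \<notin> set (hst.awalk_verts (u @ [i]) p)"
    using p(2) by (auto dest: prefix_length_le)
  then have "hst.apath b \<delta> u ((u, u @ [i]) # p) (u @ i # v)"
    using p(1) arc by (simp add: hst.apath_Cons_iff)
  moreover have "set (hst.awalk_verts u ((u, u @ [i]) # p))
      \<subseteq> {z. prefix u z \<and> prefix z (u @ i # v)}"
    using p(2) append_prefixD by (fastforce simp: prefix_def)
  moreover have "{length u<..length (u @ i # v)}
      = insert (Suc (length u)) {Suc (length u)<..length (u @ i # v)}"
    by auto
  ultimately show ?case
    using p(3) by (intro exI[of _ "(u, u @ [i]) # p"]) simp
qed

text \<open>The third assumption makes \<open>u\<close> the longest common prefix, hence the turning
  point. The path climbs from \<open>u @ w\<close> to \<open>u\<close>, one letter of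
  \<open>w\<close> per induction step, and then descends by \<open>apath_down\<close>.\<close>

lemma apath_up_down:
  assumes "u @ w \<in> pverts (hst b \<delta>)" "u @ v \<in> pverts (hst b \<delta>)"
    and "w = [] \<or> v = [] \<or> hd w \<noteq> hd v"
  shows "\<exists>p. hst.apath b \<delta> (u @ w) p (u @ v) \<and>
    set (hst.awalk_verts (u @ w) p) \<subseteq> {z. prefix z (u @ w) \<or> prefix z (u @ v)} \<and>
    sum_list (map (hst_weight lam) p) =
      (\<Sum>l\<in>{length u<..length (u @ w)}. lam ^ l) + (\<Sum>l\<in>{length u<..length (u @ v)}. lam ^ l)"
  using assms
proof (induction w rule: rev_induct)
  case Nil
  show ?case using apath_down[OF Nil(2), of lam] by fastforce
next
  case (snoc i w)
  have w: "u @ w \<in> pverts (hst b \<delta>)"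
    using snoc.prems(1) by (auto simp: hst_verts)
  have "w = [] \<or> v = [] \<or> hd w \<noteq> hd v"
    using snoc.prems(3) by (cases w) auto
  then obtain p where p: "hst.apath b \<delta> (u @ w) p (u @ v)"
    "set (hst.awalk_verts (u @ w) p) \<subseteq> {z. prefix z (u @ w) \<or> prefix z (u @ v)}"
    "sum_list (map (hst_weight lam) p) =
      (\<Sum>l\<in>{length u<..length (u @ w)}. lam ^ l) + (\<Sum>l\<in>{length u<..length (u @ v)}. lam ^ l)"
    using snoc.IH[OF w snoc.prems(2)] by blast
  have arc: "(u @ w @ [i], u @ w) \<in> parcs (hst b \<delta>)"
    using snoc.prems(1) w by (simp add: hst_arcs_iff)
  \<comment> \<open>Otherwise \<open>w @ [i]\<close> and \<open>v\<close> would begin with the same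
    letter. So the new start lies on neither branch that the shorter path may visit.\<close>
  have "\<not> prefix (w @ [i]) v"
  proof
    assume "prefix (w @ [i]) v"
    then obtain r where "v = w @ i # r" by (auto simp: prefix_def)
    with snoc.prems(3) show False by (cases w) auto
  qed
  moreover have "\<not> prefix (u @ w @ [i]) (u @ w)"
    by (auto dest: prefix_length_le)
  ultimately have "u @ w @ [i] \<notin> set (hst.awalk_verts (u @ w) p)"
    using p(2) by auto
  then have "hst.apath b \<delta> (u @ w @ [i]) ((u @ w @ [i], u @ w) # p) (u @ v)"
    using p(1) arc by (simp add: hst.apath_Cons_iff)
  moreover have "set (hst.awalk_verts (u @ w @ [i]) ((u @ w @ [i], u @ w) # p))
      \<subseteq> {z. prefix z (u @ w @ [i]) \<or> prefix z (u @ v)}"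
    using p(2) prefix_append[of _ "u @ w" "[i]"] by auto
  moreover have "{length u<..length (u @ w @ [i])}
      = insert (length (u @ w @ [i])) {length u<..length (u @ w)}"
    by auto
  ultimately show ?case
    using p(3) hst_weight_child(2)[of lam "u @ w" i]
    by (intro exI[of _ "(u @ w @ [i], u @ w) # p"]) simp
qed

text \<open>Both leaves have depth \<open>\<delta>\<close>, so the climb and the descent cross the
  same levels, whence the factor 2. With the indicator the sum has the same range for every pair,
  which allows tours to be treated level by level.\<close>

lemma hst_dist_leaves:
  assumes "x \<in> hst_leaves b \<delta>" "y \<in> hst_leaves b \<delta>"
  shows "hst_dist b \<delta> lam x y =
    (\<Sum>l=1..\<delta>. 2 * lam ^ l * of_bool (take l x \<noteq> take l y))"
proof -
  obtain u w v where uwv: "x = u @ w" "y = u @ v" "w = [] \<or> v = [] \<or> hd w \<noteq> hd v"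
    using longest_common_prefix[of x y] by blast
  have V: "x \<in> pverts (hst b \<delta>)" "y \<in> pverts (hst b \<delta>)" and len: "length x = \<delta>" "length y = \<delta>"
    using assms by (auto simp: hst_leaves_def)
  obtain p where p: "hst.apath b \<delta> x p y"
    "sum_list (map (hst_weight lam) p) = 2 * (\<Sum>l\<in>{length u<..\<delta>}. lam ^ l)"
    using apath_up_down[OF V[unfolded uwv] uwv(3), of lam] len unfolding uwv by auto
  have "(THE p. hst.apath b \<delta> x p y) = p"
    using hst_ex1_apath[OF V] p(1) by (intro the1_equality)
  then have "hst_dist b \<delta> lam x y = (\<Sum>l\<in>{length u<..\<delta>}. 2 * lam ^ l)"
    by (simp add: hst_dist_def p(2) sum_distrib_left)
  also have "\<dots> = (\<Sum>l\<in>{length u<..\<delta>}. 2 * lam ^ l * of_bool (take l x \<noteq> take l y))"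
  proof (intro sum.cong refl)
    fix l assume l: "l \<in> {length u<..\<delta>}"
    then obtain k where k: "l - length u = Suc k"
      by (metis Suc_diff_Suc greaterThanAtMost_iff)
    \<comment> \<open>Past the common prefix both remainders are nonempty, since both leaves have
      length \<open>\<delta>\<close>; then their first letters differ.\<close>
    obtain i w' j v' where "w = i # w'" "v = j # v'"
      using len l unfolding uwv by (cases w; cases v) auto
    with uwv l k have "take l x \<noteq> take l y" by simp
    then show "2 * lam ^ l = 2 * lam ^ l * of_bool (take l x \<noteq> take l y)" by simp
  qed
  also have "\<dots> = (\<Sum>l=1..\<delta>. 2 * lam ^ l * of_bool (take l x \<noteq> take l y))"
    by (intro sum.mono_neutral_left) (auto simp: uwv)
  finally show ?thesis .
qed

section \<open>Changes along cyclic and sorted lists\<close>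

definition cyclic_changes :: "'a list \<Rightarrow> nat set" where
  "cyclic_changes ys = {i. i < length ys \<and> ys ! i \<noteq> ys ! (Suc i mod length ys)}"

lemma finite_cyclic_changes: "finite (cyclic_changes ys)"
  by (simp add: cyclic_changes_def)

text \<open>If two values occur, a cyclic list has to leave each of its values somewhere, so each
  value stands at a change. The \<open>+ 1\<close> covers constant lists, which have no
  change.\<close>

lemma card_set_le_card_cyclic_changes:
  "card (set ys) \<le> card (cyclic_changes ys) + 1"
proof (cases "card (set ys) \<le> 1")
  case False
  have "set ys \<subseteq> (!) ys ` cyclic_changes ys"
  proof
    fix v assume v: "v \<in> set ys"
    let ?n = "length ys"
    show "v \<in> (!) ys ` cyclic_changes ys"
    proof (rule ccontr)
      assume none: "v \<notin> (!) ys ` cyclic_changes ys"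
      obtain i where i: "i < ?n" "ys ! i = v" using v by (auto simp: in_set_conv_nth)
      \<comment> \<open>A value that is never left propagates around the whole cycle.\<close>
      have step: "ys ! ((i + k) mod ?n) = v" for k
      proof (induction k)
        case 0
        then show ?case using i by simp
      next
        case (Suc k)
        have "(i + k) mod ?n < ?n" using i by (intro mod_less_divisor) auto
        with none Suc have "ys ! (Suc ((i + k) mod ?n) mod ?n) = v"
          by (force simp: cyclic_changes_def)
        then show ?case by (simp add: mod_Suc_eq)
      qed
      have "set ys \<subseteq> {v}"
      proof
        fix w assume "w \<in> set ys"
        then obtain j where j: "j < ?n" "ys ! j = w" by (auto simp: in_set_conv_nth)
        \<comment> \<open>\<open>j + ?n - i\<close> is a shift from \<open>i\<close> to
          \<open>j\<close> modulo the length; the added \<open>?n\<close> keeps the subtraction on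
          naturals from truncating.\<close>
        have "i + (j + ?n - i) = j + ?n" using i by simp
        then show "w \<in> {v}" using step[of "j + ?n - i"] j by simp
      qed
      then have "card (set ys) \<le> card {v}" by (intro card_mono) auto
      with False show False by simp
    qed
  qed
  then have "card (set ys) \<le> card (cyclic_changes ys)"
    using surj_card_le finite_cyclic_changes by blast
  then show ?thesis by simp
qed simp

text \<open>
  In a sorted list, a value changes at its last occurrence only, also for the wrap-around position.
\<close>
lemma card_cyclic_changes_sorted:
  fixes ys :: "'a :: linorder list"
  assumes "sorted ys"
  shows "card (cyclic_changes ys) \<le> card (set ys)"
proof (rule card_inj_on_le[where f = "(!) ys"])
  show "inj_on ((!) ys) (cyclic_changes ys)"
  proof (rule linorder_inj_onI)
    fix i j assume ij: "i < j" "i \<in> cyclic_changes ys" "j \<in> cyclic_changes ys"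
    then have "Suc i < length ys" by (auto simp: cyclic_changes_def)
    with ij have "ys ! i \<noteq> ys ! Suc i" by (auto simp: cyclic_changes_def)
    moreover have "ys ! i \<le> ys ! Suc i" "ys ! Suc i \<le> ys ! j"
      using assms ij by (auto simp: sorted_iff_nth_mono cyclic_changes_def)
    ultimately show "ys ! i \<noteq> ys ! j" by auto
  qed auto
qed (auto simp: cyclic_changes_def)

text \<open>Sorting the leaves once thus sorts their ancestors at every level, so a single tour is
  good at all levels together.\<close>

lemma take_mono_lexorder:
  fixes x y :: "'a :: linorder list"
  assumes "x \<le> y"
  shows "take l x \<le> take l y"
  using assms
proof (induction l arbitrary: x y)
  case (Suc l)
  then show ?case by (cases x; cases y) auto
qed simp

section \<open>Tour weights level by level\<close>

lemma tour_weight_hst: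
  assumes "set xs \<subseteq> hst_leaves b \<delta>"
  shows "tour_weight (hst_dist b \<delta> lam) xs =
    (\<Sum>l=1..\<delta>. 2 * lam ^ l * real (card (cyclic_changes (map (take l) xs))))"
proof -
  let ?n = "length xs"
  have "tour_weight (hst_dist b \<delta> lam) xs =
    (\<Sum>i<?n. \<Sum>l=1..\<delta>. 2 * lam ^ l * of_bool (take l (xs ! i) \<noteq> take l (xs ! (Suc i mod ?n))))"
    unfolding tour_weight_def
  proof (intro sum.cong refl hst_dist_leaves)
    fix i assume "i \<in> {..<?n}"
    then have "i < ?n" "Suc i mod ?n < ?n" by (auto intro!: mod_less_divisor)
    then show "xs ! i \<in> hst_leaves b \<delta>" "xs ! (Suc i mod ?n) \<in> hst_leaves b \<delta>"
      using assms nth_mem by blast+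
  qed
  also have "\<dots> = (\<Sum>l=1..\<delta>. 2 * lam ^ l *
      (\<Sum>i<?n. of_bool (take l (xs ! i) \<noteq> take l (xs ! (Suc i mod ?n)))))"
    by (subst sum.swap) (simp only: sum_distrib_left)
  also have "\<dots> = (\<Sum>l=1..\<delta>. 2 * lam ^ l * real (card (cyclic_changes (map (take l) xs))))"
  proof (intro sum.cong refl arg_cong2[where f = "(*)"])
    fix l
    have "cyclic_changes (map (take l) xs)
        = {i \<in> {..<?n}. take l (xs ! i) \<noteq> take l (xs ! (Suc i mod ?n))}"
      by (auto simp: cyclic_changes_def)
        (metis gr_implies_not0 gr0I mod_less_divisor nth_map)+
    then show "(\<Sum>i<?n. of_bool (take l (xs ! i) \<noteq> take l (xs ! (Suc i mod ?n))))
        = real (card (cyclic_changes (map (take l) xs)))"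
      by (simp add: sum_of_bool_eq Int_def)
  qed
  finally show ?thesis .
qed

lemma TSP_hst_le:
  assumes "set xs \<subseteq> hst_leaves b \<delta>" "0 \<le> lam"
  shows "TSP (hst_dist b \<delta> lam) (mset xs) \<le>
    (\<Sum>l=1..\<delta>. 2 * lam ^ l * real (card (take l ` set xs)))"
proof -
  let ?ys = "sort xs"
  have "TSP (hst_dist b \<delta> lam) (mset xs) \<le> tour_weight (hst_dist b \<delta> lam) ?ys"
    unfolding TSP_def by (intro Min_le imageI) (simp_all add: permutations_of_multisetI)
  also have "\<dots> = (\<Sum>l=1..\<delta>. 2 * lam ^ l * real (card (cyclic_changes (map (take l) ?ys))))"
    using assms(1) by (intro tour_weight_hst) simp
  also have "\<dots> \<le> (\<Sum>l=1..\<delta>. 2 * lam ^ l * real (card (take l ` set xs)))"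
  proof (intro sum_mono mult_left_mono)
    fix l
    have "sorted (map (take l) ?ys)"
      by (intro sorted_map_mono mono_onI take_mono_lexorder) auto
    from card_cyclic_changes_sorted[OF this]
    show "real (card (cyclic_changes (map (take l) ?ys))) \<le> real (card (take l ` set xs))"
      by simp
  qed (use assms(2) in auto)
  finally show ?thesis .
qed

text \<open>The set of ancestors at a level is the same for every ordering of the points, so the
  bound holds for each candidate tour and hence for the minimum.\<close>

lemma TSP_hst_ge:
  assumes "set xs \<subseteq> hst_leaves b \<delta>" "0 \<le> lam"
  shows "(\<Sum>l=1..\<delta>. 2 * lam ^ l * (real (card (take l ` set xs)) - 1)) \<le>
    TSP (hst_dist b \<delta> lam) (mset xs)"
  unfolding TSP_def
proof (rule Min.boundedI)
  fix t assume "t \<in> tour_weight (hst_dist b \<delta> lam) ` permutations_of_multiset (mset xs)"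
  then obtain ys where ys: "mset ys = mset xs" "t = tour_weight (hst_dist b \<delta> lam) ys"
    by (auto simp: permutations_of_multiset_def)
  from ys(1) have set: "set ys = set xs" by (rule mset_eq_setD)
  have "card (take l ` set xs) \<le> card (cyclic_changes (map (take l) ys)) + 1" for l
    using card_set_le_card_cyclic_changes[of "map (take l) ys"] set by simp
  then have "real (card (take l ` set xs)) - 1 \<le> real (card (cyclic_changes (map (take l) ys)))"
    for l by (metis Num.of_nat_simps(2) diff_le_eq of_nat_add of_nat_le_iff)
  then show "(\<Sum>l=1..\<delta>. 2 * lam ^ l * (real (card (take l ` set xs)) - 1)) \<le> t"
    using assms set unfolding ys(2)
    by (subst tour_weight_hst) (auto intro!: sum_mono mult_left_mono)
qed simp_all

section \<open>Counting leaves and sampling them\<close>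

lemma hst_leaves_eq: "hst_leaves b \<delta> = {u. set u \<subseteq> {..<b} \<and> length u = \<delta>}"
  by (auto simp: hst_leaves_def hst_verts)

lemma finite_hst_leaves: "finite (hst_leaves b \<delta>)"
  by (simp add: hst_leaves_eq finite_lists_length_eq)

lemma card_hst_leaves: "card (hst_leaves b \<delta>) = b ^ \<delta>"
  by (simp add: hst_leaves_eq card_lists_length_eq)

lemma hst_leaves_nonempty:
  assumes "b \<ge> 1"
  shows "hst_leaves b \<delta> \<noteq> {}"
  using assms card_hst_leaves[of b \<delta>] by (metis card.empty not_one_le_zero power_not_zero)

lemma take_hst_leaves:
  assumes "x \<in> hst_leaves b \<delta>" "l \<le> \<delta>"
  shows "take l x \<in> hst_leaves b l"
  using assms by (auto simp: hst_leaves_eq dest: in_set_takeD)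

lemma card_hst_leaves_below:
  assumes "v \<in> hst_leaves b l" "l \<le> \<delta>"
  shows "card {x \<in> hst_leaves b \<delta>. take l x = v} = b ^ (\<delta> - l)"
proof -
  have "{x \<in> hst_leaves b \<delta>. take l x = v} = (@) v ` hst_leaves b (\<delta> - l)"
  proof (intro equalityI subsetI)
    fix x assume "x \<in> {x \<in> hst_leaves b \<delta>. take l x = v}"
    then have "x = v @ drop l x" "drop l x \<in> hst_leaves b (\<delta> - l)"
      by (auto simp: hst_leaves_eq dest: in_set_dropD)
    then show "x \<in> (@) v ` hst_leaves b (\<delta> - l)" by blast
  qed (use assms in \<open>auto simp: hst_leaves_eq\<close>)
  then show ?thesis by (simp add: card_image inj_on_def card_hst_leaves)
qed

text \<open>Independence of the draws. With \<open>B\<close> the leaves outside the subtree of a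
  vertex, this is the probability that the sample misses that vertex.\<close>

lemma prob_replicate_pmf_subset:
  "measure_pmf.prob (replicate_pmf n p) {xs. set xs \<subseteq> B} = measure_pmf.prob p B ^ n"
proof (induction n)
  case (Suc n)
  let ?X = "{xs. set xs \<subseteq> B}"
  have "emeasure (replicate_pmf (Suc n) p) ?X
      = (\<integral>\<^sup>+x. (\<integral>\<^sup>+xs. indicator B x * indicator ?X xs \<partial>replicate_pmf n p) \<partial>p)"
    by (simp, intro nn_integral_cong) (simp add: indicator_def)
  also have "\<dots> = emeasure p B * emeasure (replicate_pmf n p) ?X"
    by (simp add: nn_integral_cmult nn_integral_multc)
  finally show ?case
    using Suc by (simp add: measure_def enn2real_mult)
qed simp

lemma prob_hst_leaves_not_below:
  assumes "b \<ge> 1" "v \<in> hst_leaves b l" "l \<le> \<delta>"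
  shows "measure_pmf.prob (pmf_of_set (hst_leaves b \<delta>)) {x. take l x \<noteq> v} = 1 - 1 / real b ^ l"
proof -
  have "measure_pmf.prob (pmf_of_set (hst_leaves b \<delta>)) {x. take l x = v}
      = real b ^ (\<delta> - l) / real b ^ \<delta>"
    using card_hst_leaves_below[OF assms(2,3)] hst_leaves_nonempty[OF assms(1)]
    by (simp add: measure_pmf_of_set finite_hst_leaves card_hst_leaves Int_def)
  also have "\<dots> = 1 / real b ^ l"
    using assms(1,3) by (simp add: power_diff)
  finally show ?thesis
    using measure_pmf.prob_compl[of "{x. take l x = v}" "pmf_of_set (hst_leaves b \<delta>)"]
    by (simp add: Compl_eq_Diff_UNIV[symmetric] Collect_neg_eq)
qed

lemma set_replicate_hst_leaves:
  assumes "b \<ge> 1" "xs \<in> set_pmf (replicate_pmf n (pmf_of_set (hst_leaves b \<delta>)))"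
  shows "set xs \<subseteq> hst_leaves b \<delta>" "length xs = n"
proof -
  show "set xs \<subseteq> hst_leaves b \<delta>" "length xs = n"
    using assms(2) hst_leaves_nonempty[OF assms(1)] by (auto simp: set_replicate_pmf finite_hst_leaves)
qed

text \<open>Finite support makes every real function of the sample integrable, as linearity and
  monotonicity of the expectation require.\<close>

lemma finite_set_replicate_hst_leaves:
  assumes "b \<ge> 1"
  shows "finite (set_pmf (replicate_pmf n (pmf_of_set (hst_leaves b \<delta>))))"
proof (rule finite_subset)
  show "finite {xs. set xs \<subseteq> hst_leaves b \<delta> \<and> length xs = n}"
    by (intro finite_lists_length_eq finite_hst_leaves)
qed (use set_replicate_hst_leaves[OF assms] in blast)

text \<open>Linearity of expectation over the vertices of level \<open>l\<close>, which are the
  words in \<open>hst_leaves b l\<close>. The event \<open>?A v\<close> says that no sampled leaf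
  lies below \<open>v\<close>.\<close>

lemma expectation_card_occupied:
  assumes "b \<ge> 1" "l \<le> \<delta>"
  shows "measure_pmf.expectation (replicate_pmf n (pmf_of_set (hst_leaves b \<delta>)))
      (\<lambda>xs. real (card (take l ` set xs))) = real b ^ l * (1 - (1 - 1 / real b ^ l) ^ n)"
proof -
  let ?P = "replicate_pmf n (pmf_of_set (hst_leaves b \<delta>))"
  let ?A = "\<lambda>v. {xs. set xs \<subseteq> {x. take l x \<noteq> v}}"
  have "measure_pmf.expectation ?P (\<lambda>xs. real (card (take l ` set xs)))
      = measure_pmf.expectation ?P (\<lambda>xs. \<Sum>v\<in>hst_leaves b l. indicator (- ?A v) xs)"
  proof (intro integral_cong_AE AE_pmfI)
    fix xs assume "xs \<in> set_pmf ?P"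
    then have "take l ` set xs \<subseteq> hst_leaves b l"
      using set_replicate_hst_leaves(1)[OF assms(1)] take_hst_leaves[OF _ assms(2)] by fast
    then have "hst_leaves b l \<inter> {v. xs \<in> - ?A v} = take l ` set xs" by auto
    then show "real (card (take l ` set xs)) = (\<Sum>v\<in>hst_leaves b l. indicator (- ?A v) xs)"
      by (simp add: indicator_def sum_of_bool_eq finite_hst_leaves)
  qed auto
  also have "\<dots> = (\<Sum>v\<in>hst_leaves b l. measure_pmf.prob ?P (- ?A v))"
    by (subst Bochner_Integration.integral_sum)
      (auto intro!: integrable_measure_pmf_finite finite_set_replicate_hst_leaves assms)
  also have "\<dots> = (\<Sum>v\<in>hst_leaves b l. 1 - (1 - 1 / real b ^ l) ^ n)"
    using measure_pmf.prob_compl[of _ ?P] assms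
    by (intro sum.cong refl)
      (simp add: Compl_eq_Diff_UNIV prob_replicate_pmf_subset prob_hst_leaves_not_below)
  finally show ?thesis by (simp add: card_hst_leaves)
qed

section \<open>Estimates for the occupied levels\<close>

lemma one_minus_inverse_power_le:
  assumes "1 \<le> m" "m \<le> real n"
  shows "(1 - 1 / m) ^ n \<le> exp (- 1)"
proof -
  \<comment> \<open>This is \<open>1 + x \<le> exp x\<close> at \<open>x = - 1 / m\<close>;
    \<open>1 \<le> m\<close> keeps the base nonnegative, so that powers are monotone.\<close>
  have "(1 - 1 / m) ^ n \<le> exp (- 1 / m) ^ n"
    using assms exp_ge_add_one_self[of "- 1 / m"] by (intro power_mono) auto
  also have "\<dots> = exp (- (real n / m))"
    by (simp add: exp_of_nat_mult[symmetric])
  also have "\<dots> \<le> exp (- 1)" using assms by simp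
  finally show ?thesis .
qed

text \<open>Put \<open>m = real b ^ l\<close>. As \<open>m \<ge> 2\<close>, the subtracted
  \<open>1\<close> costs at most \<open>m / 2\<close>, which turns the factor
  \<open>1 - exp (- 1)\<close> into \<open>1 / 2 - exp (- 1)\<close>.\<close>

lemma expectation_card_occupied_ge:
  assumes "b \<ge> 2" "1 \<le> l" "l \<le> \<delta>" "b ^ l \<le> n"
  shows "(1 / 2 - exp (- 1)) * real b ^ l \<le>
    measure_pmf.expectation (replicate_pmf n (pmf_of_set (hst_leaves b \<delta>)))
      (\<lambda>xs. real (card (take l ` set xs))) - 1"
proof -
  have "real b ^ 1 \<le> real b ^ l"
    using assms(1,2) by (intro power_increasing) auto
  then have b: "2 \<le> real b ^ l" using assms(1) by (simp add: order_trans[of 2 "real b"])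
  have "real b ^ l \<le> real n" using assms(4) by (metis of_nat_le_iff of_nat_power)
  with b have "(1 - 1 / real b ^ l) ^ n \<le> exp (- 1)"
    by (intro one_minus_inverse_power_le) auto
  then have "real b ^ l * (1 - exp (- 1)) \<le> real b ^ l * (1 - (1 - 1 / real b ^ l) ^ n)"
    using b by (intro mult_left_mono) auto
  moreover have "(1 / 2 - exp (- 1)) * real b ^ l = real b ^ l * (1 - exp (- 1)) - real b ^ l / 2"
    by (simp add: algebra_simps)
  moreover have "b \<ge> 1" using assms(1) by simp
  ultimately show ?thesis
    using b expectation_card_occupied[of b l \<delta> n] assms(3) by linarith
qed

lemma card_occupied_le:
  assumes "set xs \<subseteq> hst_leaves b \<delta>" "l \<le> \<delta>"
  shows "card (take l ` set xs) \<le> min (b ^ l) (length xs)"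
proof -
  have "card (take l ` set xs) \<le> card (hst_leaves b l)"
    using assms take_hst_leaves by (intro card_mono finite_hst_leaves) blast
  moreover have "card (take l ` set xs) \<le> length xs"
    by (metis card_image_le card_length List.finite_set le_trans)
  ultimately show ?thesis by (simp add: card_hst_leaves)
qed

text \<open>Let \<open>K\<close> be the last level with \<open>b ^ K \<le> n\<close>. Up to
  \<open>K\<close> the terms of both sums agree; beyond it \<open>lam ^ l * n\<close> decays
  geometrically and is absorbed by the summand at \<open>K\<close>, whether \<open>b * lam\<close>
  is below or above 1.\<close>

lemma sum_saturated_levels_le:
  fixes lam :: real
  assumes "b \<ge> 2" "0 < lam" "lam < 1" "b \<le> n"
  shows "(\<Sum>l=1..\<delta>. lam ^ l * real (min (b ^ l) n)) \<le>
    (1 + real b * lam / (1 - lam)) * (\<Sum>l | 1 \<le> l \<and> l \<le> \<delta> \<and> b ^ l \<le> n. (real b * lam) ^ l)"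
    (is "?L \<le> (1 + ?r) * ?S")
proof -
  obtain K where K: "b ^ K \<le> n" "n < b ^ (K + 1)"
    using ex_power_ivl1[of b n] assms by auto
  \<comment> \<open>This is where \<open>b \<le> n\<close> enters: level \<open>K\<close> has to be
    in the range of \<open>?S\<close> to absorb the tail.\<close>
  have "K \<ge> 1"
    using K(2) assms(4) by (cases K) auto
  have iff: "b ^ l \<le> n \<longleftrightarrow> l \<le> K" for l
  proof
    assume "b ^ l \<le> n"
    with K(2) have "b ^ l < b ^ (K + 1)" by linarith
    then show "l \<le> K" using assms(1) power_less_imp_less_exp[of b l "K + 1"] by simp
  next
    assume "l \<le> K"
    then have "b ^ l \<le> b ^ K" using assms(1) by (intro power_increasing) auto
    with K(1) show "b ^ l \<le> n" by linarith
  qed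
  have S: "?S = (\<Sum>l\<in>{1..min \<delta> K}. (real b * lam) ^ l)"
    by (intro sum.cong) (auto simp: iff)
  have tail: "(\<Sum>l\<in>{K<..\<delta>}. lam ^ l * real n) \<le> ?r * ?S"
  proof (cases "K < \<delta>")
    case True
    have "(\<Sum>l\<in>{K<..\<delta>}. lam ^ l) = (\<Sum>l=K+1..\<delta>. lam ^ l)"
      by (intro sum.cong) auto
    also have "\<dots> \<le> lam ^ (K + 1) / (1 - lam)"
      using True assms by (simp add: sum_gp divide_right_mono)
    \<comment> \<open>The choice of \<open>K\<close> gives \<open>n < b ^ (K + 1)\<close>, which
      matches the power of \<open>lam\<close>.\<close>
    finally have "(\<Sum>l\<in>{K<..\<delta>}. lam ^ l) * real n
        \<le> lam ^ (K + 1) / (1 - lam) * real b ^ (K + 1)"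
      using K(2) assms
      by (intro mult_mono) (auto simp: sum_nonneg simp flip: of_nat_power simp del: power_Suc)
    \<comment> \<open>One factor \<open>real b * lam\<close> goes into \<open>?r\<close>; what
      remains is a summand of \<open>?S\<close>, because
      \<open>1 \<le> K < \<delta>\<close>.\<close>
    also have "\<dots> = ?r * (real b * lam) ^ K"
      by (simp add: power_mult_distrib)
    also have "\<dots> \<le> ?r * ?S"
      unfolding S using True \<open>K \<ge> 1\<close> assms by (intro mult_left_mono member_le_sum) auto
    finally show ?thesis by (simp add: sum_distrib_right)
  next
    case False
    then show ?thesis
      using assms by (auto intro!: mult_nonneg_nonneg divide_nonneg_nonneg sum_nonneg)
  qed
  have "{1..\<delta>} = {1..min \<delta> K} \<union> {K<..\<delta>}" using \<open>K \<ge> 1\<close> by auto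
  then have "?L = (\<Sum>l\<in>{1..min \<delta> K}. lam ^ l * real (min (b ^ l) n))
      + (\<Sum>l\<in>{K<..\<delta>}. lam ^ l * real (min (b ^ l) n))"
    by (simp only:) (intro sum.union_disjoint, auto)
  also have "(\<Sum>l\<in>{1..min \<delta> K}. lam ^ l * real (min (b ^ l) n)) = ?S"
    unfolding S by (intro sum.cong refl) (simp add: iff min_absorb1 power_mult_distrib)
  also have "(\<Sum>l\<in>{K<..\<delta>}. lam ^ l * real (min (b ^ l) n))
      = (\<Sum>l\<in>{K<..\<delta>}. lam ^ l * real n)"
    by (intro sum.cong refl) (simp add: iff min_def)
  finally show ?thesis using tail by (simp add: algebra_simps)
qed

section \<open>Bounds for the expected optimal tour\<close>

lemma expectation_TSP_bounds:
  fixes lam :: real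
  assumes "b \<ge> 2" "0 < lam" "lam < 1" "b \<le> n"
  defines "S \<equiv> \<lambda>\<delta>. \<Sum>l | 1 \<le> l \<and> l \<le> \<delta> \<and> b ^ l \<le> n. (real b * lam) ^ l"
  shows "(1 - 2 * exp (- 1)) * S \<delta> \<le>
      measure_pmf.expectation (random_submultiset n (hst_leaves b \<delta>)) (TSP (hst_dist b \<delta> lam))"
    and "measure_pmf.expectation (random_submultiset n (hst_leaves b \<delta>)) (TSP (hst_dist b \<delta> lam))
      \<le> 2 * (1 + real b * lam / (1 - lam)) * S \<delta>"
proof -
  let ?P = "replicate_pmf n (pmf_of_set (hst_leaves b \<delta>))"
  let ?T = "\<lambda>xs. TSP (hst_dist b \<delta> lam) (mset xs)"
  let ?I = "{l. 1 \<le> l \<and> l \<le> \<delta> \<and> b ^ l \<le> n}"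
  let ?occ = "\<lambda>l xs. real (card (take l ` set xs))"
  have I: "finite ?I" "?I \<subseteq> {1..\<delta>}"
    by (auto intro: finite_subset[of _ "{..\<delta>}"])
  have int: "integrable (measure_pmf ?P) f" for f :: "_ \<Rightarrow> real"
    using assms by (intro integrable_measure_pmf_finite finite_set_replicate_hst_leaves) simp
  have E: "measure_pmf.expectation (random_submultiset n (hst_leaves b \<delta>)) (TSP (hst_dist b \<delta> lam))
      = measure_pmf.expectation ?P ?T"
    by (simp add: random_submultiset_def)
  have xs: "set xs \<subseteq> hst_leaves b \<delta>" "length xs = n" if "xs \<in> set_pmf ?P" for xs
    using set_replicate_hst_leaves[OF _ that] assms(1) by simp_all

  \<comment> \<open>The constant is \<open>2 * (1 / 2 - exp (- 1))\<close>: the factor 2 of the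
    distance times the fraction from \<open>expectation_card_occupied_ge\<close>.\<close>
  have "(1 - 2 * exp (- 1)) * S \<delta>
      = (\<Sum>l\<in>?I. 2 * lam ^ l * ((1 / 2 - exp (- 1)) * real b ^ l))"
    unfolding S_def sum_distrib_left
    by (intro sum.cong refl) (simp add: power_mult_distrib algebra_simps)
  also have "\<dots> \<le> (\<Sum>l\<in>?I. 2 * lam ^ l * (measure_pmf.expectation ?P (?occ l) - 1))"
    using assms by (intro sum_mono mult_left_mono expectation_card_occupied_ge) auto
  also have "\<dots> = measure_pmf.expectation ?P (\<lambda>xs. \<Sum>l\<in>?I. 2 * lam ^ l * (?occ l xs - 1))"
    by (simp add: int)
  also have "\<dots> \<le> measure_pmf.expectation ?P ?T"
  proof (intro integral_mono_AE int AE_pmfI)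
    fix ys assume ys: "ys \<in> set_pmf ?P"
    \<comment> \<open>A nonempty sample occupies a vertex at every level, so the levels with
      \<open>b ^ l > n\<close> contribute nonnegative terms and restricting the sum to
      \<open>?I\<close> only lowers it.\<close>
    have "set ys \<noteq> {}" using xs(2)[OF ys] assms(1,4) by auto
    then have "card (take l ` set ys) \<ge> 1" for l
      by (simp add: Suc_le_eq card_gt_0_iff)
    then have "(\<Sum>l\<in>?I. 2 * lam ^ l * (?occ l ys - 1)) \<le> (\<Sum>l=1..\<delta>. 2 * lam ^ l * (?occ l ys - 1))"
      using assms(2) I(2) by (intro sum_mono2) auto
    also have "\<dots> \<le> ?T ys" using xs(1)[OF ys] assms(2) by (intro TSP_hst_ge) auto
    finally show "(\<Sum>l\<in>?I. 2 * lam ^ l * (?occ l ys - 1)) \<le> ?T ys" .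
  qed
  finally show "(1 - 2 * exp (- 1)) * S \<delta> \<le>
      measure_pmf.expectation (random_submultiset n (hst_leaves b \<delta>)) (TSP (hst_dist b \<delta> lam))"
    unfolding E .

  \<comment> \<open>The upper bound holds for each sample separately, hence for the
    expectation.\<close>
  have "measure_pmf.expectation ?P ?T
      \<le> measure_pmf.expectation ?P (\<lambda>_. 2 * (\<Sum>l=1..\<delta>. lam ^ l * real (min (b ^ l) n)))"
  proof (intro integral_mono_AE int AE_pmfI)
    fix ys assume ys: "ys \<in> set_pmf ?P"
    have "?T ys \<le> (\<Sum>l=1..\<delta>. 2 * lam ^ l * ?occ l ys)"
      using xs(1)[OF ys] assms(2) by (intro TSP_hst_le) auto
    also have "\<dots> \<le> (\<Sum>l=1..\<delta>. 2 * lam ^ l * real (min (b ^ l) n))"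
      using card_occupied_le[OF xs(1)[OF ys]] xs(2)[OF ys] assms(2)
      by (intro sum_mono mult_left_mono of_nat_mono) auto
    finally show "?T ys \<le> 2 * (\<Sum>l=1..\<delta>. lam ^ l * real (min (b ^ l) n))"
      by (simp only: sum_distrib_left mult.assoc)
  qed
  also have "\<dots> \<le> 2 * ((1 + real b * lam / (1 - lam)) * S \<delta>)"
    using sum_saturated_levels_le[OF assms(1-4)] unfolding S_def by simp
  finally show "measure_pmf.expectation (random_submultiset n (hst_leaves b \<delta>)) (TSP (hst_dist b \<delta> lam))
      \<le> 2 * (1 + real b * lam / (1 - lam)) * S \<delta>"
    unfolding E by (simp only: mult.assoc)
qed

theorem theorem6:
  fixes b :: nat and lam :: real
  assumes "b \<ge> 2" and "0 < lam" and "lam < 1"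
  shows "\<exists>c>0. \<exists>C>0. \<forall>\<delta>\<ge>1. \<forall>n\<ge>b.
    (let h = min (real \<delta>) (log (real b) (real n));
         S = (\<Sum>l | 1 \<le> l \<and> real l \<le> h. (real b * lam) ^ l);
         E = measure_pmf.expectation (random_submultiset n (hst_leaves b \<delta>)) (TSP (hst_dist b \<delta> lam))
     in c * S \<le> E \<and> E \<le> C * S)"
proof -
  \<comment> \<open>Equivalent to \<open>exp 1 > 2\<close>, that is, to
    \<open>ln 2 < 1\<close>.\<close>
  have c: "0 < 1 - 2 * exp (- 1 :: real)"
  proof -
    have "(2 :: real) < exp 1" using ln_2_less_1 by (metis exp_less_cancel_iff exp_ln zero_less_numeral)
    then show ?thesis by (simp add: exp_minus field_simps)
  qed
  have C: "0 < 2 * (1 + real b * lam / (1 - lam))"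
    using assms by (simp add: add_pos_nonneg)
  \<comment> \<open>\<open>l \<le> log b n\<close> means \<open>b ^ l \<le> n\<close>, so the real
    bound \<open>h\<close> selects exactly the levels summed in
    \<open>expectation_TSP_bounds\<close>.\<close>
  have levels: "{l. 1 \<le> l \<and> real l \<le> min (real \<delta>) (log (real b) (real n))}
      = {l. 1 \<le> l \<and> l \<le> \<delta> \<and> b ^ l \<le> n}" if "n \<ge> b" for \<delta> n
  proof -
    have "real l \<le> log (real b) (real n) \<longleftrightarrow> b ^ l \<le> n" for l
      using assms(1) that by (simp add: le_log_iff powr_realpow flip: of_nat_power)
    then show ?thesis by auto
  qed
  show ?thesis
  proof (rule exI[of _ "1 - 2 * exp (- 1)"], intro conjI c,
      rule exI[of _ "2 * (1 + real b * lam / (1 - lam))"], intro conjI C allI impI)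
    fix \<delta> n assume "n \<ge> b"
    then show "let h = min (real \<delta>) (log (real b) (real n));
         S = (\<Sum>l | 1 \<le> l \<and> real l \<le> h. (real b * lam) ^ l);
         E = measure_pmf.expectation (random_submultiset n (hst_leaves b \<delta>)) (TSP (hst_dist b \<delta> lam))
       in (1 - 2 * exp (- 1)) * S \<le> E \<and> E \<le> 2 * (1 + real b * lam / (1 - lam)) * S"
      unfolding Let_def levels[OF \<open>n \<ge> b\<close>] using expectation_TSP_bounds[OF assms] by blast
  qed
qed

end
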